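(* Let $CP_3(n)$ be defined by $\sum_{n\ge 0} CP_3(n)q^n = \dfrac{f_3^6f_6^6}{f_1^2f_2^2}$. Then for all integers $k\ge 1$ and $n\ge 1$, \[ CP_3(2\cdot 3^kn+3^k-2)\equiv 0\pmod{2\cdot 3^{k-1}}. \]
   Context: For $|q|<1$ and integer $m\ge 1$, $f_m := (q^m;q^m)_\infty=\prod_{n\ge1}(1-q^{mn})$. $CP_3(n)$ is the number of $3$-core cubic bipartitions of $n$, defined by the generating function $\sum_{n\ge0}CP_3(n)q^n = \frac{f_3^6f_6^6}{f_1^2f_2^2}$. *)

theory Defs
  imports
    "HOL-Analysis.Infinite_Products"
    "HOL-Computational_Algebra.Formal_Power_Series"
    "HOL-Number_Theory.Cong"
begin

text \<open>
  Generating functions are formal power series in \<open>q = fps_X\<close> with integer coefficients, and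
  infinite products of them converge in the \<open>q\<close>-adic metric of the type \<open>int fps\<close>. The factor
  \<open>1 - q^(m n)\<close>, \<open>n \<ge> 1\<close>, has index \<open>n - 1\<close>. Only \<open>m \<ge> 1\<close> is meaningful.
\<close>

definition euler_f :: "nat \<Rightarrow> int fps" where
  "euler_f m = (\<Prod>n. 1 - fps_X ^ (m * Suc n))"

text \<open>
  There is no division on \<open>int fps\<close>. The denominator has constant term \<open>1\<close>, so its reciprocal
  exists over the integers and is \<open>fps_right_inverse _ 1\<close>; see \<open>CP3_generating_function\<close>.
\<close>

definition CP3 :: "nat \<Rightarrow> int" where
  "CP3 n = fps_nth (euler_f 3 ^ 6 * euler_f 6 ^ 6 *
      fps_right_inverse (euler_f 1 ^ 2 * euler_f 2 ^ 2) 1) n"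

lemma euler_f_partial_nth:
  assumes "m > 0" "n \<ge> i"
  shows "fps_nth (\<Prod>k\<le>n. 1 - fps_X ^ (m * Suc k) :: int fps) i
       = fps_nth (\<Prod>k\<le>i. 1 - fps_X ^ (m * Suc k) :: int fps) i"
  using assms(2)
proof (induction n rule: dec_induct)
  case (step n)
  have "i < m * Suc (Suc n)"
    using step.hyps assms(1) by (cases m) auto
  then show ?case
    using step.IH
    by (simp add: right_diff_distrib fps_X_power_mult_right_nth del: mult_Suc_right power_Suc)
qed simp

lemma euler_f_has_prod:
  assumes "m > 0"
  shows "(\<lambda>n. 1 - fps_X ^ (m * Suc n)) has_prod euler_f m"
    and "fps_nth (euler_f m) 0 = 1"
proof -
  let ?P = "\<lambda>n. (\<Prod>k\<le>n. 1 - fps_X ^ (m * Suc k) :: int fps)"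
  define L where "L = Abs_fps (\<lambda>i. fps_nth (?P i) i)"
  have L0: "fps_nth L 0 = 1"
    using assms by (simp add: L_def)
  have "?P \<longlonglongrightarrow> L"
  proof (rule tendsto_fpsI)
    fix i
    show "\<forall>\<^sub>F n in sequentially. fps_nth (?P n) i = fps_nth L i"
      using eventually_ge_at_top[of i]
      by eventually_elim (unfold L_def fps_nth_Abs_fps, rule euler_f_partial_nth[OF assms])
  qed
  moreover have "L \<noteq> 0"
    using L0 by auto
  ultimately have *: "(\<lambda>n. 1 - fps_X ^ (m * Suc n)) has_prod L"
    unfolding has_prod_def raw_has_prod_def add_0_right by blast
  then have "L = euler_f m"
    unfolding euler_f_def by (rule has_prod_unique)
  with * L0 show "(\<lambda>n. 1 - fps_X ^ (m * Suc n)) has_prod euler_f m" "fps_nth (euler_f m) 0 = 1"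
    by simp_all
qed

lemma CP3_generating_function:
  "Abs_fps CP3 * (euler_f 1 ^ 2 * euler_f 2 ^ 2) = euler_f 3 ^ 6 * euler_f 6 ^ 6"
proof -
  let ?D = "euler_f 1 ^ 2 * euler_f 2 ^ 2"
  define D where "D = ?D"
  define R where "R = fps_right_inverse D 1"
  have "fps_nth D 0 = 1"
    by (simp only: D_def fps_mult_nth_0 fps_nth_power_0 euler_f_has_prod(2) zero_less_one
        zero_less_numeral power_one mult_1_right)
  then have DR: "D * R = 1"
    unfolding R_def using fps_right_inverse[of D 1] by simp
  have "Abs_fps CP3 = euler_f 3 ^ 6 * euler_f 6 ^ 6 * R"
    by (rule fps_ext) (simp only: fps_nth_Abs_fps CP3_def R_def D_def)
  then have "Abs_fps CP3 * D = euler_f 3 ^ 6 * euler_f 6 ^ 6 * (D * R)"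
    by (simp only: ac_simps)
  then show ?thesis
    unfolding DR mult_1_right unfolding D_def .
qed

end

theory Submission
  imports Defs
begin

text \<open>
  Put \<open>F = q\<^sup>2 \<Sum> CP\<^sub>3(n) q\<^sup>n\<close> and \<open>C = q (f\<^sub>1 f\<^sub>2 f\<^sub>3 f\<^sub>6)\<^sup>2\<close>, the cusp form of weight 4 and level 6,
  and let \<open>U\<close> extract the coefficients at multiples of 3. Then \<open>U F = 27 F + 2 C\<close> and
  \<open>U C = - 3 C\<close>, so the coefficient of \<open>F\<close> at \<open>3^k m\<close> is divisible by \<open>3^(k - 1)\<close>. Evenness at odd
  indices holds because the generating function is the square of an integral power series.

  Both relations follow from a 3-dissection \<open>f\<^sub>1 f\<^sub>2 = A - q B - q\<^sup>2 E\<close>, where \<open>A\<close>, \<open>B = f\<^sub>9 f\<^sub>1\<^sub>8\<close> and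
  \<open>E\<close> are series in \<open>q\<^sup>3\<close> with \<open>A E = 2 B\<^sup>2\<close>. It is obtained from
  \<open>2 f\<^sub>1 f\<^sub>2 = (\<Sum> (-1)^k q^(k\<^sup>2)) (\<Sum> q^(k (k + 1) / 2))\<close>, with sums over all integers \<open>k\<close>, by splitting
  \<open>k\<close> modulo 3 and evaluating the parts with the Jacobi triple product. To divide by
  \<open>(f\<^sub>1 f\<^sub>2)\<^sup>2\<close> one needs the product of the conjugates of \<open>f\<^sub>1 f\<^sub>2\<close> under \<open>q \<mapsto> \<omega> q\<close>, \<open>\<omega>\<^sup>3 = 1\<close>,
  which is \<open>(f\<^sub>3 f\<^sub>6)^4 / (f\<^sub>9 f\<^sub>1\<^sub>8)\<close>.
\<close>

unbundle fps_syntax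
no_notation vec_nth (infixl "$" 90)

section \<open>Convergence of formal power series\<close>

lemma tendsto_mult_fps:
  fixes f g :: "'b \<Rightarrow> 'a::comm_ring_1 fps"
  assumes "(f \<longlongrightarrow> a) F" "(g \<longlongrightarrow> b) F"
  shows "((\<lambda>x. f x * g x) \<longlongrightarrow> a * b) F"
proof (rule tendsto_fpsI)
  fix n
  have "\<forall>\<^sub>F x in F. \<forall>i\<in>{..n}. f x $ i = a $ i" "\<forall>\<^sub>F x in F. \<forall>i\<in>{..n}. g x $ i = b $ i"
    using assms unfolding tendsto_fps_iff by (auto simp: eventually_ball_finite_distrib)
  then show "\<forall>\<^sub>F x in F. (f x * g x) $ n = (a * b) $ n"
    by eventually_elim (simp add: fps_mult_nth)
qed

lemma tendsto_add_fps:
  fixes f g :: "'b \<Rightarrow> 'a::comm_ring_1 fps"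
  assumes "(f \<longlongrightarrow> a) F" "(g \<longlongrightarrow> b) F"
  shows "((\<lambda>x. f x + g x) \<longlongrightarrow> a + b) F"
proof (rule tendsto_fpsI)
  fix n
  have "\<forall>\<^sub>F x in F. f x $ n = a $ n" "\<forall>\<^sub>F x in F. g x $ n = b $ n"
    using assms unfolding tendsto_fps_iff by auto
  then show "\<forall>\<^sub>F x in F. (f x + g x) $ n = (a + b) $ n"
    by eventually_elim simp
qed

lemma tendsto_power_fps:
  fixes f :: "'b \<Rightarrow> 'a::comm_ring_1 fps"
  assumes "(f \<longlongrightarrow> a) F"
  shows "((\<lambda>x. f x ^ k) \<longlongrightarrow> a ^ k) F"
  by (induction k) (auto intro: tendsto_mult_fps assms)

lemma tendsto_diff_fps:
  fixes f g :: "'b \<Rightarrow> 'a::comm_ring_1 fps"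
  assumes "(f \<longlongrightarrow> a) F" "(g \<longlongrightarrow> b) F"
  shows "((\<lambda>x. f x - g x) \<longlongrightarrow> a - b) F"
  using tendsto_add_fps[OF assms(1) tendsto_mult_fps[OF tendsto_const[of "-1"] assms(2)]] by simp

lemma fps_X_power_dvd_iff: "fps_X ^ n dvd (x :: 'a::comm_ring_1 fps) \<longleftrightarrow> (\<forall>i<n. x $ i = 0)"
proof
  assume "fps_X ^ n dvd x"
  then show "\<forall>i<n. x $ i = 0"
    by (auto simp: fps_X_power_mult_nth)
next
  assume "\<forall>i<n. x $ i = 0"
  then have "fps_cutoff n x = 0"
    by (auto simp: fps_eq_iff)
  then have "x = fps_X ^ n * fps_shift n x"
    using fps_shift_cutoff'[of n x] by simp
  then show "fps_X ^ n dvd x" ..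
qed

lemma tendsto_fps_iff_dvd:
  "(f \<longlongrightarrow> (a :: 'a::comm_ring_1 fps)) F \<longleftrightarrow> (\<forall>n. \<forall>\<^sub>F x in F. fps_X ^ n dvd f x - a)"
proof
  assume *: "(f \<longlongrightarrow> a) F"
  show "\<forall>n. \<forall>\<^sub>F x in F. fps_X ^ n dvd f x - a"
  proof
    fix n
    have "\<forall>\<^sub>F x in F. \<forall>i\<in>{..<n}. f x $ i = a $ i"
      using * unfolding tendsto_fps_iff by (auto simp: eventually_ball_finite_distrib)
    then show "\<forall>\<^sub>F x in F. fps_X ^ n dvd f x - a"
      by eventually_elim (simp add: fps_X_power_dvd_iff)
  qed
next
  assume *: "\<forall>n. \<forall>\<^sub>F x in F. fps_X ^ n dvd f x - a"
  show "(f \<longlongrightarrow> a) F"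
  proof (rule tendsto_fpsI)
    fix n
    show "\<forall>\<^sub>F x in F. f x $ n = a $ n"
      using *[rule_format, of "Suc n"] by eventually_elim (simp add: fps_X_power_dvd_iff del: power_Suc)
  qed
qed

text \<open>\<open>u\<close> has order 0, and orders add in an integral domain. This stands in for
  division by products with constant term 1.\<close>

lemma fps_X_power_dvd_cancel_left:
  fixes u x :: "'a::idom fps"
  assumes "u $ 0 \<noteq> 0" "fps_X ^ n dvd u * x"
  shows "fps_X ^ n dvd x"
proof (cases "x = 0")
  case False
  have [simp]: "subdegree u = 0" "u \<noteq> 0" using assms(1) by auto
  have "i < n \<Longrightarrow> x $ i = 0" for i
  proof -
    assume "i < n"
    have "n \<le> subdegree (u * x)"
      using assms(2) False by (intro subdegree_geI) (auto simp: fps_X_power_dvd_iff)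
    then have "n \<le> subdegree x" using False by simp
    then show ?thesis using \<open>i < n\<close> nth_less_subdegree_zero[of i x] by simp
  qed
  then show ?thesis by (auto simp: fps_X_power_dvd_iff)
qed simp

section \<open>Infinite q-Pochhammer symbols\<close>

text \<open>
  The coefficient of \<open>q^i\<close> is read off the first \<open>i + 1\<close> factors of \<open>(a; q^m)\<close>, which gives the infinite
  product only for \<open>m > 0\<close>.
\<close>
definition qpoch :: "int fps \<Rightarrow> nat \<Rightarrow> int fps" where
  "qpoch a m = Abs_fps (\<lambda>i. (\<Prod>j\<le>i. 1 - a * fps_X ^ (m * j)) $ i)"

text \<open>Factors with \<open>j \<ge> l\<close> are 1 modulo \<open>q^(m l)\<close>, so they do
  not change the product to that order, and the limit inherits the bound.\<close>

lemma qpoch_minus_partial: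
  assumes "m > 0"
  shows "fps_X ^ (m * l) dvd qpoch a m - (\<Prod>j<l. 1 - a * fps_X ^ (m * j))"
    and "(\<lambda>n. \<Prod>j<n. 1 - a * fps_X ^ (m * j)) \<longlonglongrightarrow> qpoch a m"
proof -
  let ?P = "\<lambda>n. \<Prod>j<n. 1 - a * fps_X ^ (m * j)"
  have step: "fps_X ^ (m * l) dvd ?P n - ?P l" if "n \<ge> l" for n l
    using that
  proof (induction n rule: dec_induct)
    case (step n)
    have "?P (Suc n) - ?P l = (?P n - ?P l) - ?P n * a * fps_X ^ (m * n)"
      by (simp add: algebra_simps)
    moreover have "(fps_X :: int fps) ^ (m * l) dvd fps_X ^ (m * n)"
      using step.hyps by (intro le_imp_power_dvd) simp
    ultimately show ?case using step.IH by (metis dvd_diff dvd_mult)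
  qed simp
  show lim: "?P \<longlonglongrightarrow> qpoch a m"
  proof (rule tendsto_fpsI)
    fix i
    show "\<forall>\<^sub>F n in sequentially. ?P n $ i = qpoch a m $ i"
      using eventually_ge_at_top[of "Suc i"]
    proof eventually_elim
      case (elim n)
      \<comment> \<open>Since \<open>m \<ge> 1\<close>, the first \<open>i + 1\<close> factors
        already fix the coefficient of \<open>q^i\<close>.\<close>
      have "(fps_X :: int fps) ^ Suc i dvd fps_X ^ (m * Suc i)"
        using assms mult_le_mono1[of 1 m "Suc i"] by (intro le_imp_power_dvd) simp
      then have "fps_X ^ Suc i dvd ?P n - ?P (Suc i)"
        using step[OF elim] dvd_trans by blast
      then have "(?P n - ?P (Suc i)) $ i = 0"
        unfolding fps_X_power_dvd_iff by blast
      then show ?case by (simp add: qpoch_def lessThan_Suc_atMost)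
    qed
  qed
  have "\<forall>\<^sub>F n in sequentially. fps_X ^ (m * l) dvd ?P n - qpoch a m"
    using lim unfolding tendsto_fps_iff_dvd by blast
  then have "\<forall>\<^sub>F n in sequentially. n \<ge> l \<and> fps_X ^ (m * l) dvd ?P n - qpoch a m"
    using eventually_ge_at_top eventually_conj by blast
  then obtain n where "n \<ge> l" "fps_X ^ (m * l) dvd ?P n - qpoch a m"
    unfolding eventually_sequentially by blast
  then have "fps_X ^ (m * l) dvd (?P n - ?P l) - (?P n - qpoch a m)"
    using step by (intro dvd_diff[of _ _ "?P n - qpoch a m"])
  then show "fps_X ^ (m * l) dvd qpoch a m - ?P l"
    by simp
qed

lemmas qpoch_tendsto = qpoch_minus_partial(2)

lemma qpoch_nth_0: "qpoch a m $ 0 = 1 - a $ 0"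
  by (simp add: qpoch_def)

lemma euler_f_eq_qpoch:
  assumes "m > 0"
  shows "euler_f m = qpoch (fps_X ^ m) m"
proof -
  have "euler_f m \<noteq> 0"
    using euler_f_has_prod(2)[OF assms] by auto
  then have "(\<lambda>n. \<Prod>k\<le>n. 1 - fps_X ^ (m * Suc k)) \<longlonglongrightarrow> euler_f m"
    using euler_f_has_prod(1)[OF assms] unfolding has_prod_def raw_has_prod_def by simp
  moreover have "(\<lambda>n. \<Prod>k<Suc n. 1 - fps_X ^ m * fps_X ^ (m * k)) \<longlonglongrightarrow> qpoch (fps_X ^ m) m"
    using qpoch_tendsto[OF assms] by (rule LIMSEQ_Suc)
  ultimately show ?thesis
    by (intro LIMSEQ_unique) (simp_all add: lessThan_Suc_atMost power_add)
qed

text \<open>Factors of even and odd index are separated, which is exact along the partial products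
  of length \<open>2 * n\<close>.\<close>

lemma qpoch_split:
  assumes "m > 0"
  shows "qpoch a m = qpoch a (2 * m) * qpoch (a * fps_X ^ m) (2 * m)"
proof -
  let ?P = "\<lambda>a m n. \<Prod>j<n. 1 - a * fps_X ^ (m * j)"
  have "?P a m (2 * n) = ?P a (2 * m) n * ?P (a * fps_X ^ m) (2 * m) n" for n
    by (induction n) (simp_all add: power_add algebra_simps)
  then have "(\<lambda>n. ?P a m (2 * n)) \<longlonglongrightarrow> qpoch a (2 * m) * qpoch (a * fps_X ^ m) (2 * m)"
    using assms by (simp add: tendsto_mult_fps qpoch_tendsto)
  moreover have "strict_mono (\<lambda>n :: nat. 2 * n)"
    by (simp add: strict_mono_def)
  then have "(\<lambda>n. ?P a m (2 * n)) \<longlonglongrightarrow> qpoch a m"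
    using LIMSEQ_subseq_LIMSEQ[OF qpoch_tendsto[OF assms, of a]] by (simp add: o_def)
  ultimately show ?thesis
    by (rule LIMSEQ_unique[symmetric])
qed

lemma qpoch_mult_minus:
  assumes "m > 0"
  shows "qpoch a m * qpoch (- a) m = qpoch (a ^ 2) (2 * m)"
proof -
  let ?P = "\<lambda>a m n. \<Prod>j<n. 1 - a * fps_X ^ (m * j)"
  have "?P a m n * ?P (- a) m n = ?P (a ^ 2) (2 * m) n" for n
    unfolding prod.distrib [symmetric]
    by (rule prod.cong) (simp_all add: algebra_simps power_mult power2_eq_square power_mult_distrib)
  moreover have "(\<lambda>n. ?P a m n * ?P (- a) m n) \<longlonglongrightarrow> qpoch a m * qpoch (- a) m"
    using assms by (intro tendsto_mult_fps qpoch_tendsto)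
  ultimately show ?thesis
    using assms by (simp add: LIMSEQ_unique qpoch_tendsto)
qed

section \<open>The Jacobi triple product\<close>

fun qbinom :: "'a::comm_ring_1 \<Rightarrow> nat \<Rightarrow> nat \<Rightarrow> 'a" where
  "qbinom p n 0 = 1"
| "qbinom p 0 (Suc r) = 0"
| "qbinom p (Suc n) (Suc r) = qbinom p n (Suc r) + p ^ (n - r) * qbinom p n r"

lemma qbinom_eq_0: "n < r \<Longrightarrow> qbinom p n r = 0"
  by (induction p n r rule: qbinom.induct) auto

lemma qbinom_self: "qbinom p n n = 1"
  by (induction n) (auto simp: qbinom_eq_0)

text \<open>The quotient formula with denominators cleared. Pascal's rule reduces it to (1 - p^s) +
  (1 - p^r) p^s = 1 - p^(r + s).\<close>

lemma qbinom_fact: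
  "(\<Prod>j<r. 1 - p ^ Suc j) * (\<Prod>j<s. 1 - p ^ Suc j) * qbinom p (r + s) r = (\<Prod>j<r + s. 1 - p ^ Suc j)"
proof (induction "r + s" arbitrary: r s)
  case (Suc n)
  show ?case
  proof (cases r; cases s)
    fix r' s' assume rs: "r = Suc r'" "s = Suc s'"
    let ?P = "\<lambda>r. \<Prod>j<r. 1 - p ^ Suc j"
    have n: "n = r' + s" "n = r + s'" using Suc(2) rs by auto
    have e: "qbinom p (r + s) r = qbinom p (r + s') r + p ^ s * qbinom p (r' + s) r'"
      using rs by simp
    have "?P r * ?P s * qbinom p (r + s) r
      = (1 - p ^ s) * (?P r * ?P s' * qbinom p (r + s') r)
        + (1 - p ^ r) * p ^ s * (?P r' * ?P s * qbinom p (r' + s) r')"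
      unfolding e using rs by (simp add: algebra_simps)
    also have "\<dots> = (1 - p ^ s) * ?P n + (1 - p ^ r) * p ^ s * ?P n"
      using Suc(1)[OF n(1)] Suc(1)[OF n(2)] n by simp
    also have "\<dots> = ?P n * (1 - p ^ (r + s))"
      by (simp add: algebra_simps power_add)
    also have "\<dots> = ?P (r + s)"
      using Suc(2) by (metis prod.lessThan_Suc)
    finally show ?thesis .
  qed (use qbinom_self[of p r] in \<open>auto simp del: qbinom.simps(3)\<close>)
qed simp

text \<open>The mirrored Pascal rule, needed to adjoin factors in \<open>b\<close> to the finite
  triple product, as the defining rule adjoins factors in \<open>a\<close>.\<close>

lemma qbinom_Suc_Suc':
  "qbinom p (Suc n) (Suc r) = qbinom p n r + p ^ Suc r * qbinom p n (Suc r)"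
proof (induction n arbitrary: r)
  case 0
  then show ?case by (cases r) auto
next
  case (Suc n)
  show ?case
  proof (cases r)
    case 0
    have "qbinom p (Suc (Suc n)) (Suc 0) = qbinom p (Suc n) (Suc 0) + p ^ Suc n"
      by simp
    also have "\<dots> = 1 + p * qbinom p n (Suc 0) + p ^ Suc n"
      using Suc.IH[of 0] by simp
    also have "\<dots> = 1 + p * qbinom p (Suc n) (Suc 0)"
      by (simp add: algebra_simps)
    finally show ?thesis using 0 by simp
  next
    case (Suc r')
    show ?thesis
    proof (cases "r \<le> n")
      case True
      \<comment> \<open>Both sides are \<open>p ^ Suc n\<close>; the two expansions differ only in
        this coefficient.\<close>
      have e: "p ^ Suc r * p ^ (n - r) = p ^ (n - r') * p ^ Suc r'"
        using True Suc by (simp flip: power_add power_Suc)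
      have "qbinom p (Suc (Suc n)) (Suc r)
          = qbinom p (Suc n) (Suc r) + p ^ (n - r') * qbinom p (Suc n) r"
        using Suc by simp
      also have "\<dots> = (qbinom p n r + p ^ Suc r * qbinom p n (Suc r))
          + p ^ (n - r') * (qbinom p n r' + p ^ Suc r' * qbinom p n r)"
        using Suc.IH[of r] Suc.IH[of r'] Suc by simp
      also have "\<dots> = (qbinom p n r + p ^ (n - r') * qbinom p n r')
          + p ^ Suc r * qbinom p n (Suc r) + (p ^ (n - r') * p ^ Suc r') * qbinom p n r"
        by (simp add: algebra_simps)
      also have "\<dots> = qbinom p (Suc n) r + p ^ Suc r * qbinom p (Suc n) (Suc r)"
        unfolding e[symmetric] using Suc by (simp add: algebra_simps)
      finally show ?thesis .
    next
      case False
      then show ?thesis by (auto simp: qbinom_eq_0)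
    qed
  qed
qed

definition tri :: "int \<Rightarrow> nat" where
  "tri k = nat (k * (k + 1) div 2)"

lemma two_times_tri: "2 * int (tri k) = k * (k + 1)"
proof -
  have "k * (k + 1) \<ge> 0"
    by (cases "k \<ge> 0") (auto simp: mult_nonpos_nonpos)
  then show ?thesis by (simp add: tri_def)
qed

text \<open>The general term of Ramanujan's theta function f(a, b), with exponents k(k + 1)/2 and
  k(k - 1)/2.\<close>

definition theta_term :: "'a::comm_ring_1 \<Rightarrow> 'a \<Rightarrow> int \<Rightarrow> 'a" where
  "theta_term a b k = a ^ tri k * b ^ tri (k - 1)"

lemma tri_rec: "int (tri k) = int (tri (k - 1)) + k"
proof -
  have "2 * int (tri k) = 2 * int (tri (k - 1)) + 2 * k"
    unfolding two_times_tri by (simp add: algebra_simps)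
  then show ?thesis by simp
qed

text \<open>Follows by comparing the exponents of \<open>a\<close> and of \<open>b\<close>. It
  trades the new summand \<open>a * (a * b) ^ n\<close> of a factor for an index shift;
  \<open>k \<le> int n\<close> keeps \<open>n - k\<close> genuine.\<close>

lemma theta_term_shift_a:
  fixes k :: int
  assumes "k \<le> int n"
  shows "a * (a * b) ^ n * theta_term a b k = (a * b) ^ nat (int n - k) * theta_term a b (k + 1)"
proof -
  have "Suc (n + tri k) = nat (int n - k) + tri (k + 1)" "n + tri (k - 1) = nat (int n - k) + tri k"
    using tri_rec[of "k + 1"] tri_rec[of k] assms by auto
  then have "a ^ Suc (n + tri k) * b ^ (n + tri (k - 1))
     = a ^ (nat (int n - k) + tri (k + 1)) * b ^ (nat (int n - k) + tri k)"
    by simp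
  then show ?thesis
    unfolding theta_term_def power_mult_distrib power_add power_Suc
    by (simp add: ac_simps)
qed

lemma theta_term_shift_b:
  "b * (a * b) ^ m * theta_term a b (int r - int m) = (a * b) ^ r * theta_term a b (int r - int m - 1)"
proof -
  have "m + tri (int r - int m) = r + tri (int r - int m - 1)"
       "Suc (m + tri (int r - int m - 1)) = r + tri (int r - int m - 1 - 1)"
    using tri_rec[of "int r - int m"] tri_rec[of "int r - int m - 1"] by auto
  then have "a ^ (m + tri (int r - int m)) * b ^ (Suc (m + tri (int r - int m - 1)))
     = a ^ (r + tri (int r - int m - 1)) * b ^ (r + tri (int r - int m - 1 - 1))"
    by simp
  then show ?thesis
    unfolding theta_term_def power_mult_distrib power_add power_Suc
    by (simp add: ac_simps)
qed

text \<open>The q-binomial theorem: the new factor splits each term in two, and the part with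
  \<open>a\<close> moves to index \<open>r + 1\<close>, as in Pascal's rule.\<close>

lemma finite_q_binomial:
  "(\<Prod>j<n. 1 + a * (a * b) ^ j) = (\<Sum>r\<le>n. qbinom (a * b) n r * theta_term a b (int r))"
proof (induction n)
  case 0
  then show ?case by (simp add: theta_term_def tri_def)
next
  case (Suc n)
  let ?p = "a * b" and ?t = "\<lambda>r. theta_term a b (int r)"
  have "(\<Sum>r\<le>Suc n. qbinom ?p (Suc n) r * ?t r)
    = ?t 0 + (\<Sum>r\<le>n. qbinom ?p (Suc n) (Suc r) * ?t (Suc r))"
    by (subst sum.atMost_Suc_shift) simp
  also have "\<dots> = (?t 0 + (\<Sum>r\<le>n. qbinom ?p n (Suc r) * ?t (Suc r)))
      + (\<Sum>r\<le>n. ?p ^ (n - r) * qbinom ?p n r * ?t (Suc r))"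
    by (simp add: algebra_simps sum.distrib)
  also have "?t 0 + (\<Sum>r\<le>n. qbinom ?p n (Suc r) * ?t (Suc r)) = (\<Sum>r\<le>Suc n. qbinom ?p n r * ?t r)"
    using sum.atMost_Suc_shift[of "\<lambda>r. qbinom ?p n r * ?t r" n] by simp
  also have "\<dots> = (\<Sum>r\<le>n. qbinom ?p n r * ?t r)"
    by (simp add: qbinom_eq_0)
  also have "(\<Sum>r\<le>n. ?p ^ (n - r) * qbinom ?p n r * ?t (Suc r))
      = (\<Sum>r\<le>n. a * ?p ^ n * (qbinom ?p n r * ?t r))"
  proof (rule sum.cong)
    fix r assume "r \<in> {..n}"
    then have "nat (int n - int r) = n - r" "int r \<le> int n" by auto
    then have e: "?p ^ (n - r) * ?t (Suc r) = a * ?p ^ n * ?t r"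
      using theta_term_shift_a[of "int r" n a b] by (simp add: add.commute)
    have "?p ^ (n - r) * qbinom ?p n r * ?t (Suc r) = qbinom ?p n r * (?p ^ (n - r) * ?t (Suc r))"
      by (simp only: ac_simps)
    then show "?p ^ (n - r) * qbinom ?p n r * ?t (Suc r) = a * ?p ^ n * (qbinom ?p n r * ?t r)"
      unfolding e by (simp only: ac_simps)
  qed simp
  also have "(\<Sum>r\<le>n. qbinom ?p n r * ?t r) + (\<Sum>r\<le>n. a * ?p ^ n * (qbinom ?p n r * ?t r))
      = (\<Sum>r\<le>n. qbinom ?p n r * ?t r) * (1 + a * ?p ^ n)"
    by (simp add: algebra_simps sum_distrib_left sum.distrib)
  finally show ?case
    using Suc.IH by simp
qed

text \<open>Induction on \<open>m\<close> from the q-binomial theorem. A factor in \<open>b\<close>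
  lowers the theta index by one, and the mirrored Pascal rule collects the terms.\<close>

lemma finite_jacobi_triple_product:
  "(\<Prod>j<n. 1 + a * (a * b) ^ j) * (\<Prod>j<m. 1 + b * (a * b) ^ j)
   = (\<Sum>r\<le>n + m. qbinom (a * b) (n + m) r * theta_term a b (int r - int m))"
proof (induction m)
  case 0
  then show ?case by (simp add: finite_q_binomial)
next
  case (Suc m)
  let ?p = "a * b" and ?t = "\<lambda>m r. theta_term a b (int r - int m)"
  define N where "N = n + m"
  have t: "?t (Suc m) (Suc r) = ?t m r" for r by simp
  have "(\<Sum>r\<le>Suc N. qbinom ?p (Suc N) r * ?t (Suc m) r)
    = ?t (Suc m) 0 + (\<Sum>r\<le>N. qbinom ?p (Suc N) (Suc r) * ?t m r)"
    by (subst sum.atMost_Suc_shift) (simp only: t qbinom.simps(1) mult_1_left)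
  also have "\<dots> = (?t (Suc m) 0 + (\<Sum>r\<le>N. ?p ^ Suc r * qbinom ?p N (Suc r) * ?t m r))
      + (\<Sum>r\<le>N. qbinom ?p N r * ?t m r)"
    unfolding qbinom_Suc_Suc' by (simp only: distrib_right sum.distrib add_ac)
  also have "?t (Suc m) 0 + (\<Sum>r\<le>N. ?p ^ Suc r * qbinom ?p N (Suc r) * ?t m r)
      = (\<Sum>r\<le>Suc N. ?p ^ r * qbinom ?p N r * ?t (Suc m) r)"
    using sum.atMost_Suc_shift[of "\<lambda>r. ?p ^ r * qbinom ?p N r * ?t (Suc m) r" N]
    by (simp only: t qbinom.simps(1) mult_1_left power_0)
  also have "\<dots> = (\<Sum>r\<le>N. ?p ^ r * qbinom ?p N r * ?t (Suc m) r)"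
    by (simp add: qbinom_eq_0)
  also have "\<dots> = (\<Sum>r\<le>N. b * ?p ^ m * (qbinom ?p N r * ?t m r))"
  proof (rule sum.cong)
    fix r assume "r \<in> {..N}"
    have "int r - int (Suc m) = int r - int m - 1" by simp
    then show "?p ^ r * qbinom ?p N r * ?t (Suc m) r = b * ?p ^ m * (qbinom ?p N r * ?t m r)"
      using theta_term_shift_b[of b a m r] by (simp only: ac_simps)
  qed simp
  also have "\<dots> + (\<Sum>r\<le>N. qbinom ?p N r * ?t m r) = (\<Sum>r\<le>N. qbinom ?p N r * ?t m r) * (1 + b * ?p ^ m)"
    by (simp add: algebra_simps sum_distrib_left sum.distrib)
  finally show ?case
    unfolding prod.lessThan_Suc[of _ m] mult.assoc[symmetric] Suc.IH N_def add_Suc_right by (rule sym)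
qed

text \<open>All finite products in the quotient formula agree with \<open>qpoch p m\<close> to this
  order, so the q-binomial coefficient is close to its reciprocal.\<close>

lemma qbinom_euler:
  fixes p :: "int fps"
  assumes "p = fps_X ^ m" "m > 0" "l \<le> r" "l \<le> s"
  shows "fps_X ^ (m * Suc l) dvd qpoch p m * qbinom p (r + s) r - 1"
proof -
  define P where "P r = (\<Prod>j<r. 1 - p ^ Suc j)" for r
  define E where "E = qpoch p m"
  define d where "d = m * Suc l"
  have P: "\<exists>c. P r = E + fps_X ^ d * c" if "l \<le> r" for r
  proof -
    have "P r * (1 - p ^ Suc r) = (\<Prod>j<Suc r. 1 - p * fps_X ^ (m * j))"
      by (simp add: P_def assms(1) power_mult)
    then have "fps_X ^ (m * Suc r) dvd E - P r * (1 - p ^ Suc r)"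
      using qpoch_minus_partial(1)[OF assms(2), of "Suc r" p] unfolding E_def by simp
    moreover have "p ^ Suc r = fps_X ^ (m * Suc r)"
      by (simp add: assms(1) flip: power_mult del: power_Suc mult_Suc_right)
    ultimately have "fps_X ^ (m * Suc r) dvd E - P r * (1 - p ^ Suc r) - P r * p ^ Suc r"
      by (metis dvd_diff dvd_triv_right)
    then have "fps_X ^ (m * Suc r) dvd E - P r"
      by (simp add: algebra_simps)
    then have "fps_X ^ d dvd E - P r"
      using that unfolding d_def by (meson dvd_trans le_imp_power_dvd mult_le_mono2 Suc_le_mono)
    then obtain c where "E - P r = fps_X ^ d * c" ..
    then have "P r = E + fps_X ^ d * (- c)"
      by (simp add: algebra_simps)
    then show ?thesis ..
  qed
  obtain u v w where e: "P r = E + fps_X ^ d * u" "P s = E + fps_X ^ d * v" "P (r + s) = E + fps_X ^ d * w"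
    using P[of r] P[of s] P[of "r + s"] assms by auto
  have "P r * P s * (E * qbinom p (r + s) r - 1) = E * P (r + s) - P r * P s"
    using qbinom_fact[where p = p and r = r and s = s] unfolding P_def[symmetric]
    by (simp add: right_diff_distrib mult.assoc mult.left_commute del: mult_cancel_left)
  also have "\<dots> = fps_X ^ d * (E * w - E * u - E * v - fps_X ^ d * u * v)"
    unfolding e by (simp add: algebra_simps)
  finally have *: "fps_X ^ d dvd P r * P s * (E * qbinom p (r + s) r - 1)"
    by simp
  have "P r $ 0 = 1" for r
    using assms(1,2) unfolding P_def
    by (induction r) (simp_all add: fps_mult_nth_0 zero_power)
  then show ?thesis
    using fps_X_power_dvd_cancel_left[OF _ *] unfolding E_def d_def by simp
qed

text \<open>Both exponents are bounded through \<open>tri j \<ge> j\<close> and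
  \<open>tri j \<ge> - j - 1\<close>. This makes up for the precision that
  \<open>qbinom_euler\<close> loses away from the centre.\<close>

lemma theta_term_dvd: "(a * b) ^ nat (\<bar>k\<bar> - 1) dvd theta_term a b k"
proof -
  have *: "nat (\<bar>k\<bar> - 1) \<le> tri j" if "j = k \<or> j = k - 1" for j
  proof -
    have "0 \<le> j * (j - 1)" "0 \<le> (j + 1) * (j + 2)"
      by (cases "j \<ge> 1"; simp add: mult_nonpos_nonpos)
         (cases "j \<ge> -1"; simp add: mult_nonpos_nonpos)
    then have "2 * \<bar>j\<bar> - 2 \<le> 2 * int (tri j)" "- 2 * j - 2 \<le> 2 * int (tri j)"
      unfolding two_times_tri by (auto simp: algebra_simps abs_if)
    moreover have "j \<le> int (tri j)"
      using tri_rec[of j] by simp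
    ultimately show ?thesis using that by auto
  qed
  show ?thesis
    unfolding theta_term_def power_mult_distrib
    by (intro mult_dvd_mono le_imp_power_dvd *) auto
qed

lemma sum_symmetric_int_interval:
  "(\<Sum>k=- int n..int n. f k) = (\<Sum>r\<le>n + n. f (int r - int n))"
  by (rule sum.reindex_bij_witness[of _ "\<lambda>r. int r - int n" "\<lambda>k. nat (k + int n)"]) auto

text \<open>The finite identity with equally many factors in \<open>a\<close> and \<open>b\<close>
  is multiplied by \<open>E\<close>. Near the centre the q-binomials are almost 1/E; far from it the
  theta terms have high order.\<close>

theorem jacobi_triple_product:
  fixes a b :: "int fps"
  assumes "a * b = fps_X ^ m" "m > 0"
  shows "(\<lambda>n. \<Sum>k=- int n..int n. theta_term a b k)
    \<longlonglongrightarrow> qpoch (fps_X ^ m) m * qpoch (- a) m * qpoch (- b) m"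
proof -
  define p :: "int fps" where "p = fps_X ^ m"
  define E where "E = qpoch p m"
  let ?F = "\<lambda>n. (\<Prod>j<n. 1 + a * p ^ j) * (\<Prod>j<n. 1 + b * p ^ j)"
  let ?S = "\<lambda>n. \<Sum>k=- int n..int n. theta_term a b k"
  have lim: "(\<lambda>n. E * ?F n) \<longlonglongrightarrow> E * (qpoch (- a) m * qpoch (- b) m)"
    using qpoch_tendsto[OF assms(2), of "- a"] qpoch_tendsto[OF assms(2), of "- b"]
    by (intro tendsto_mult_fps tendsto_const) (simp_all add: p_def power_mult)
  have dvd: "fps_X ^ n dvd E * ?F n - ?S n" for n
  proof -
    have "E * ?F n - ?S n = (\<Sum>r\<le>n + n. (E * qbinom p (n + n) r - 1) * theta_term a b (int r - int n))"
      unfolding sum_symmetric_int_interval p_def assms(1)[symmetric] finite_jacobi_triple_product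
      by (simp add: sum_distrib_left sum_subtractf algebra_simps)
    also have "fps_X ^ n dvd \<dots>"
    proof (rule dvd_sum)
      fix r assume "r \<in> {..n + n}"
      then obtain s where s: "n + n = r + s" by (metis atMost_iff le_Suc_ex)
      define k where "k = int r - int n"
      have "fps_X ^ (m * Suc (min r s)) dvd E * qbinom p (n + n) r - 1"
        unfolding s E_def using assms(2) by (intro qbinom_euler) (auto simp: p_def)
      moreover have "fps_X ^ (m * nat (\<bar>k\<bar> - 1)) dvd theta_term a b k"
        using theta_term_dvd[of a b k] unfolding assms(1) by (simp add: power_mult)
      ultimately have "fps_X ^ (m * Suc (min r s) + m * nat (\<bar>k\<bar> - 1))
          dvd (E * qbinom p (n + n) r - 1) * theta_term a b k"
        unfolding power_add by (rule mult_dvd_mono)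
      \<comment> \<open>As r + s = 2n, \<open>min r s\<close> is n - |k|: what the first estimate
        loses, the second regains.\<close>
      moreover have "n \<le> Suc (min r s) + nat (\<bar>k\<bar> - 1)"
        using s unfolding k_def by auto
      then have "m * n \<le> m * Suc (min r s) + m * nat (\<bar>k\<bar> - 1)"
        by (metis distrib_left mult_le_mono2)
      then have "n \<le> m * Suc (min r s) + m * nat (\<bar>k\<bar> - 1)"
        using assms(2) by (cases m) auto
      ultimately show "fps_X ^ n dvd (E * qbinom p (n + n) r - 1) * theta_term a b (int r - int n)"
        unfolding k_def by (meson dvd_trans le_imp_power_dvd)
    qed
    finally show ?thesis .
  qed
  have "(\<lambda>n. E * ?F n - ?S n) \<longlonglongrightarrow> 0"
    unfolding tendsto_fps_iff_dvd
  proof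
    fix N
    show "\<forall>\<^sub>F n in sequentially. fps_X ^ N dvd E * ?F n - ?S n - 0"
      using eventually_ge_at_top[of N]
    proof eventually_elim
      case (elim n)
      then have "fps_X ^ N dvd (fps_X ^ n :: int fps)" by (rule le_imp_power_dvd)
      then show ?case using dvd[of n] unfolding diff_0_right by (rule dvd_trans)
    qed
  qed
  from tendsto_diff_fps[OF lim this] show ?thesis
    by (simp add: E_def p_def mult.assoc)
qed

lemma qpoch_unroll:
  assumes "m > 0"
  shows "qpoch a m = (1 - a) * qpoch (a * fps_X ^ m) m"
proof -
  have "(\<Prod>j<Suc n. 1 - a * fps_X ^ (m * j)) = (1 - a) * (\<Prod>j<n. 1 - a * fps_X ^ m * fps_X ^ (m * j))" for n
    by (subst prod.lessThan_Suc_shift) (simp add: power_add mult.assoc)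
  then have "(\<lambda>n. \<Prod>j<Suc n. 1 - a * fps_X ^ (m * j)) \<longlonglongrightarrow> (1 - a) * qpoch (a * fps_X ^ m) m"
    using assms by (simp only:) (intro tendsto_mult_fps tendsto_const qpoch_tendsto)
  with LIMSEQ_Suc[OF qpoch_tendsto[OF assms]] show ?thesis
    by (rule LIMSEQ_unique)
qed

section \<open>Dissection of theta functions\<close>

text \<open>Ramanujan's f(a, b) in product form, meant for \<open>a * b = fps_X ^ m\<close>;
  \<open>theta_tendsto\<close> gives its bilateral series.\<close>

definition theta :: "int fps \<Rightarrow> int fps \<Rightarrow> nat \<Rightarrow> int fps" where
  "theta a b m = qpoch (fps_X ^ m) m * qpoch (- a) m * qpoch (- b) m"

lemma theta_commute: "theta a b m = theta b a m"
  by (simp add: theta_def ac_simps)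

lemma theta_tendsto:
  assumes "a * b = fps_X ^ m" "m > 0"
  shows "(\<lambda>n. \<Sum>k=- int n..int n. theta_term a b k) \<longlonglongrightarrow> theta a b m"
  using jacobi_triple_product[OF assms] by (simp only: theta_def)

lemma sum_symmetric_Suc:
  "(\<Sum>k=- int (Suc n)..int (Suc n). f k) = (\<Sum>k=- int n..int n. f k) + f (int n + 1) + f (- int n - 1)"
proof -
  have "{- int (Suc n)..int (Suc n)} = insert (int n + 1) (insert (- int n - 1) {- int n..int n})"
    by auto
  then show ?thesis by (simp add: ac_simps)
qed

text \<open>The bound \<open>3 * n + 1\<close> and the representatives 0, 1, -1 give all three
  classes the same symmetric range of \<open>l\<close>.\<close>

lemma sum_symmetric_dissect_3:
  fixes f :: "int \<Rightarrow> 'a::comm_monoid_add"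
  shows "(\<Sum>k=- int (3 * n + 1)..int (3 * n + 1). f k)
    = (\<Sum>l=- int n..int n. f (3 * l)) + (\<Sum>l=- int n..int n. f (3 * l + 1)) + (\<Sum>l=- int n..int n. f (3 * l - 1))"
proof (induction n)
  case 0
  have "{-1..1::int} = {0, 1, -1}" by auto
  then show ?case by (simp add: ac_simps)
next
  case (Suc n)
  have e: "3 * Suc n + 1 = Suc (Suc (Suc (3 * n + 1)))" by simp
  have "int (Suc (Suc (3 * n + 1))) + 1 = 3 * (int n + 1) + 1" "- int (Suc (Suc (3 * n + 1))) - 1 = 3 * (- int n - 1) - 1"
     "int (Suc (3 * n + 1)) + 1 = 3 * (int n + 1)" "- int (Suc (3 * n + 1)) - 1 = 3 * (- int n - 1)"
     "int (3 * n + 1) + 1 = 3 * (int n + 1) - 1" "- int (3 * n + 1) - 1 = 3 * (- int n - 1) + 1"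
    by auto
  then show ?case
    unfolding e sum_symmetric_Suc[of f] sum_symmetric_Suc[of _ n] Suc.IH
    by (simp only: ac_simps)
qed

text \<open>The limit is taken along the bounds \<open>3 * n + 1\<close>. \<open>c2\<close> and
  \<open>c3\<close> are what remains once each class is written as a theta series again.\<close>

lemma theta_dissect_3:
  assumes "a * b = fps_X ^ m" "m > 0"
    and "a1 * b1 = fps_X ^ m1" "m1 > 0" "\<And>l. theta_term a b (3 * l) = theta_term a1 b1 l"
    and "a2 * b2 = fps_X ^ m2" "m2 > 0" "\<And>l. theta_term a b (3 * l + 1) = c2 * theta_term a2 b2 l"
    and "a3 * b3 = fps_X ^ m3" "m3 > 0" "\<And>l. theta_term a b (3 * l - 1) = c3 * theta_term a3 b3 l"
  shows "theta a b m = theta a1 b1 m1 + c2 * theta a2 b2 m2 + c3 * theta a3 b3 m3"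
proof -
  let ?S = "\<lambda>a b n. \<Sum>k=- int n..int n. theta_term a b k"
  have "(\<lambda>n. ?S a b (3 * n + 1)) \<longlonglongrightarrow> theta a b m"
    using LIMSEQ_subseq_LIMSEQ[OF theta_tendsto[OF assms(1,2)], of "\<lambda>n. 3 * n + 1"]
    by (simp add: o_def strict_mono_def)
  moreover have "?S a b (3 * n + 1) = ?S a1 b1 n + c2 * ?S a2 b2 n + c3 * ?S a3 b3 n" for n
    unfolding sum_symmetric_dissect_3 assms(5,8,11) sum_distrib_left ..
  moreover have "(\<lambda>n. ?S a1 b1 n + c2 * ?S a2 b2 n + c3 * ?S a3 b3 n)
      \<longlonglongrightarrow> theta a1 b1 m1 + c2 * theta a2 b2 m2 + c3 * theta a3 b3 m3"
    using assms by (intro tendsto_add_fps tendsto_mult_fps tendsto_const theta_tendsto)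
  ultimately show ?thesis
    by (simp only: LIMSEQ_unique)
qed

text \<open>The series is the sum of (-1)^k q^(k^2). The map k -> -k exchanges the classes 1 and -1,
  whence the coefficient 2.\<close>

lemma theta_phi_dissect:
  "theta (- fps_X) (- fps_X) 2 = theta (- (fps_X ^ 9)) (- (fps_X ^ 9)) 18
     - 2 * fps_X * theta (- (fps_X ^ 15)) (- (fps_X ^ 3)) 18"
proof -
  \<comment> \<open>Powers of \<open>- fps_X\<close> carry the signs, since 9, 15 and 3 are
    odd.\<close>
  define a :: "int fps" where "a = - fps_X"
  have pow: "theta_term (a ^ i) (a ^ j) k = a ^ (i * tri k + j * tri (k - 1))" for i j k
    by (simp add: theta_term_def power_mult power_add)
  have t: "theta_term a a k = a ^ (tri k + tri (k - 1))" for k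
    by (simp add: theta_term_def power_add)
  have "theta a a 2 = theta (a ^ 9) (a ^ 9) 18 + a * theta (a ^ 15) (a ^ 3) 18 + a * theta (a ^ 3) (a ^ 15) 18"
  proof (rule theta_dissect_3)
    fix l :: int
    note tt = two_times_tri[of l] two_times_tri[of "l - 1"] two_times_tri[of "3 * l"] two_times_tri[of "3 * l - 1"]
       two_times_tri[of "3 * l - 1 - 1"] two_times_tri[of "3 * l + 1"]
    have "int (tri (3 * l) + tri (3 * l - 1)) = int (9 * tri l + 9 * tri (l - 1))"
      using tt by (simp add: algebra_simps)
    then show "theta_term a a (3 * l) = theta_term (a ^ 9) (a ^ 9) l"
      unfolding pow t by (simp only: of_nat_eq_iff)
    have "int (tri (3 * l + 1) + tri (3 * l)) = int (Suc (15 * tri l + 3 * tri (l - 1)))"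
      using tt by (simp add: algebra_simps)
    then show "theta_term a a (3 * l + 1) = a * theta_term (a ^ 15) (a ^ 3) l"
      unfolding pow t add_diff_cancel_right' by (simp only: of_nat_eq_iff power_Suc)
    have "int (tri (3 * l - 1) + tri (3 * l - 1 - 1)) = int (Suc (3 * tri l + 15 * tri (l - 1)))"
      using tt by (simp add: algebra_simps)
    then show "theta_term a a (3 * l - 1) = a * theta_term (a ^ 3) (a ^ 15) l"
      unfolding pow t by (simp only: of_nat_eq_iff power_Suc)
  qed (auto simp: a_def power2_eq_square simp flip: power_add)
  also have "theta (a ^ 3) (a ^ 15) 18 = theta (a ^ 15) (a ^ 3) 18"
    by (rule theta_commute)
  finally show ?thesis
    by (simp add: a_def algebra_simps)
qed

text \<open>The series is the sum of q^(k(k + 1)/2) over all integers. The reflection k -> -1 - k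
  exchanges the classes 0 and -1 and preserves the class 1.\<close>

lemma theta_psi_dissect:
  "theta fps_X 1 1 = 2 * theta (fps_X ^ 3) (fps_X ^ 6) 9 + fps_X * theta (fps_X ^ 9) 1 9"
proof -
  have pow: "theta_term ((fps_X :: int fps) ^ i) (fps_X ^ j) k = fps_X ^ (i * tri k + j * tri (k - 1))" for i j k
    by (simp add: theta_term_def power_mult power_add)
  have t: "theta_term (a :: int fps) 1 k = a ^ tri k" for a k
    by (simp add: theta_term_def)
  have "theta fps_X 1 1 = theta (fps_X ^ 6) (fps_X ^ 3) 9 + fps_X * theta (fps_X ^ 9) 1 9 + 1 * theta (fps_X ^ 3) (fps_X ^ 6) 9"
  proof (rule theta_dissect_3)
    fix l :: int
    note tt = two_times_tri[of l] two_times_tri[of "l - 1"] two_times_tri[of "3 * l"] two_times_tri[of "3 * l - 1"]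
       two_times_tri[of "3 * l + 1"]
    have "int (tri (3 * l)) = int (6 * tri l + 3 * tri (l - 1))"
      using tt by (simp add: algebra_simps)
    then show "theta_term fps_X (1 :: int fps) (3 * l) = theta_term (fps_X ^ 6) (fps_X ^ 3) l"
      unfolding pow t by (simp only: of_nat_eq_iff)
    have "int (tri (3 * l + 1)) = int (Suc (9 * tri l))"
      using tt by (simp add: algebra_simps)
    then show "theta_term fps_X (1 :: int fps) (3 * l + 1) = fps_X * theta_term (fps_X ^ 9) 1 l"
      unfolding t power_mult[symmetric] by (simp only: of_nat_eq_iff power_Suc)
    have "int (tri (3 * l - 1)) = int (3 * tri l + 6 * tri (l - 1))"
      using tt by (simp add: algebra_simps)
    then show "theta_term fps_X (1 :: int fps) (3 * l - 1) = 1 * theta_term (fps_X ^ 3) (fps_X ^ 6) l"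
      unfolding pow t mult_1_left by (simp only: of_nat_eq_iff)
  qed (auto simp flip: power_add)
  also have "theta (fps_X ^ 6) (fps_X ^ 3) 9 = theta (fps_X ^ 3) (fps_X ^ 6) 9"
    by (rule theta_commute)
  finally show ?thesis
    by (simp add: algebra_simps)
qed

lemma qpoch_X_power_nonzero: "c > 0 \<Longrightarrow> qpoch (fps_X ^ c) m \<noteq> 0"
  using qpoch_nth_0[of "fps_X ^ c" m] by auto

text \<open>With u = (q^s; q^(2s)) and v = (-q^s; q^s) the product is 2 f_s f_(2s) (u v)^2, and u v
  = 1 is Euler's identity between odd and distinct parts.\<close>

lemma theta_phi_times_psi:
  assumes "s > 0"
  shows "theta (- (fps_X ^ s)) (- (fps_X ^ s)) (2 * s) * theta (fps_X ^ s) 1 s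
    = 2 * (euler_f s * euler_f (2 * s))"
proof -
  define a :: "int fps" where "a = fps_X ^ s"
  define u v where "u = qpoch a (2 * s)" and "v = qpoch (- a) s"
  have f: "euler_f s = qpoch a s" "euler_f (2 * s) = qpoch (a\<^sup>2) (2 * s)"
    using euler_f_eq_qpoch[of s] euler_f_eq_qpoch[of "2 * s"] assms
    by (simp_all add: a_def power_mult[symmetric] mult.commute)
  have 1: "euler_f s = u * euler_f (2 * s)"
    using qpoch_split[OF assms, of a] by (simp add: f u_def a_def power2_eq_square)
  have 2: "euler_f s * v = euler_f (2 * s)"
    using qpoch_mult_minus[OF assms, of a] by (simp add: f v_def)
  have "euler_f (2 * s) * (u * v) = euler_f (2 * s) * 1"
    using 1 2 by (simp add: mult.assoc mult.left_commute)
  moreover have "euler_f (2 * s) \<noteq> 0"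
    using euler_f_has_prod(2)[of "2 * s"] assms by auto
  ultimately have 3: "u * v = 1"
    by (metis mult_left_cancel)
  \<comment> \<open>The argument 1 of \<open>theta\<close> gives a product whose first factor is 1 +
    1, the source of the 2.\<close>
  have "qpoch (- 1) s = 2 * v"
    using qpoch_unroll[OF assms, of "- 1"] by (simp add: v_def a_def)
  then have "theta a 1 s = euler_f s * v * (2 * v)"
    using assms by (simp add: theta_def euler_f_eq_qpoch v_def a_def)
  moreover have "theta (- a) (- a) (2 * s) = euler_f (2 * s) * u * u"
    using assms by (simp add: theta_def euler_f_eq_qpoch u_def a_def)
  ultimately have "theta (- a) (- a) (2 * s) * theta a 1 s
      = euler_f (2 * s) * u * u * (euler_f s * v * (2 * v))"
    by (simp only:)
  also have "\<dots> = 2 * (euler_f s * euler_f (2 * s)) * (u * v) * (u * v)"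
    by (simp add: ac_simps)
  finally show ?thesis
    by (simp add: 3 a_def)
qed

text \<open>All factors are split modulo \<open>6 * s\<close>. The relations Q1 Q4 u = Q2 and Q2 Q5
  v = Q4 multiply to Q1 Q5 u v = 1, which leaves only Euler products.\<close>

lemma theta_omega_times_pi:
  assumes "s > 0"
  shows "theta (- (fps_X ^ (5 * s))) (- (fps_X ^ s)) (6 * s) * theta (fps_X ^ s) (fps_X ^ (2 * s)) (3 * s)
    = euler_f (3 * s) * euler_f (6 * s)"
proof -
  define Q where "Q k = qpoch (fps_X ^ (k * s)) (6 * s)" for k
  define u v where "u = qpoch (- (fps_X ^ s)) (3 * s)" and "v = qpoch (- (fps_X ^ (2 * s))) (3 * s)"
  have e: "2 * (3 * s) = 6 * s" by simp
  have s3: "3 * s > 0" using assms by simp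
  have "qpoch (fps_X ^ s) (3 * s) = Q 1 * Q 4"
    using qpoch_split[OF s3, of "fps_X ^ s"] unfolding e Q_def by (simp flip: power_add)
  moreover have "qpoch (fps_X ^ (2 * s)) (3 * s) = Q 2 * Q 5"
    using qpoch_split[OF s3, of "fps_X ^ (2 * s)"] unfolding e Q_def by (simp flip: power_add)
  ultimately have 1: "Q 1 * Q 4 * u = Q 2" "Q 2 * Q 5 * v = Q 4"
    using qpoch_mult_minus[OF s3, of "fps_X ^ s"] qpoch_mult_minus[OF s3, of "fps_X ^ (2 * s)"]
    unfolding e u_def v_def Q_def by (simp_all add: mult.commute flip: power_mult)
  have "(Q 2 * Q 4) * (Q 5 * Q 1 * u * v) = (Q 1 * Q 4 * u) * (Q 2 * Q 5 * v)"
    by (simp add: ac_simps)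
  also have "\<dots> = (Q 2 * Q 4) * 1"
    unfolding 1 by simp
  finally have "Q 5 * Q 1 * u * v = 1"
    using qpoch_X_power_nonzero[of "2 * s"] qpoch_X_power_nonzero[of "4 * s"] assms
    by (simp add: mult_left_cancel Q_def)
  moreover have "theta (- (fps_X ^ (5 * s))) (- (fps_X ^ s)) (6 * s) * theta (fps_X ^ s) (fps_X ^ (2 * s)) (3 * s)
      = (Q 5 * Q 1 * u * v) * (euler_f (3 * s) * euler_f (6 * s))"
    using assms by (simp add: theta_def Q_def u_def v_def euler_f_eq_qpoch ac_simps)
  ultimately show ?thesis by simp
qed

section \<open>Residue classes of exponents modulo 3\<close>

definition supp3 :: "nat \<Rightarrow> 'a::zero fps \<Rightarrow> bool" where
  "supp3 i x \<longleftrightarrow> (\<forall>n. x $ n \<noteq> 0 \<longrightarrow> n mod 3 = i)"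

lemma supp3_mult:
  fixes x y :: "'a::comm_ring_1 fps"
  assumes "supp3 i x" "supp3 j y" "k = (i + j) mod 3"
  shows "supp3 k (x * y)"
  unfolding supp3_def
proof (intro allI impI)
  fix n assume "(x * y) $ n \<noteq> 0"
  then obtain l where l: "l \<le> n" "x $ l * y $ (n - l) \<noteq> 0"
    unfolding fps_mult_nth by (metis (no_types, lifting) atLeastAtMost_iff sum.not_neutral_contains_not_neutral)
  then have "l mod 3 = i" "(n - l) mod 3 = j"
    using assms unfolding supp3_def by (metis mult_zero_left mult_zero_right)+
  then show "n mod 3 = k"
    using l(1) assms(3) by (metis le_add_diff_inverse mod_add_eq)
qed

lemma supp3_add: "supp3 i x \<Longrightarrow> supp3 i y \<Longrightarrow> supp3 i (x + y :: 'a::comm_ring_1 fps)"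
  unfolding supp3_def fps_add_nth by (metis add.right_neutral add.left_neutral)

lemma supp3_uminus: "supp3 i x \<Longrightarrow> supp3 i (- x :: 'a::comm_ring_1 fps)"
  by (simp add: supp3_def)

lemma supp3_diff: "supp3 i x \<Longrightarrow> supp3 i y \<Longrightarrow> supp3 i (x - y :: 'a::comm_ring_1 fps)"
  using supp3_add[OF _ supp3_uminus, of i x y] by simp

lemma supp3_1: "supp3 0 1"
  by (simp add: supp3_def)

lemma supp3_numeral: "supp3 0 (numeral n :: 'a::comm_ring_1 fps)"
  by (auto simp: supp3_def fps_numeral_nth)

lemma supp3_X_power: "k mod 3 = i \<Longrightarrow> supp3 i (fps_X ^ k :: 'a::comm_ring_1 fps)"
  by (simp add: supp3_def)

lemma supp3_power: "supp3 0 x \<Longrightarrow> supp3 0 (x ^ k :: 'a::comm_ring_1 fps)"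
  by (induction k) (auto intro: supp3_1 supp3_mult[of 0 _ 0])

lemma supp3_prod: "(\<And>j. j \<in> A \<Longrightarrow> supp3 0 (f j)) \<Longrightarrow> supp3 0 (prod f A :: 'a::comm_ring_1 fps)"
  by (induction A rule: infinite_finite_induct) (auto intro: supp3_1 supp3_mult[of 0 _ 0])

lemma supp3_qpoch:
  assumes "supp3 0 a" "3 dvd m"
  shows "supp3 0 (qpoch a m)"
proof -
  have "supp3 0 (\<Prod>j\<le>n. 1 - a * fps_X ^ (m * j))" for n
    using assms by (intro supp3_prod supp3_diff supp3_1 supp3_mult[of 0 _ 0] supp3_X_power) auto
  then show ?thesis
    by (simp add: supp3_def qpoch_def)
qed

lemma supp3_theta: "supp3 0 a \<Longrightarrow> supp3 0 b \<Longrightarrow> 3 dvd m \<Longrightarrow> supp3 0 (theta a b m)"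
  unfolding theta_def
  by (intro supp3_mult[of 0 _ 0] supp3_qpoch supp3_X_power supp3_uminus) auto

lemma supp3_euler_f: "m > 0 \<Longrightarrow> 3 dvd m \<Longrightarrow> supp3 0 (euler_f m)"
  by (simp add: euler_f_eq_qpoch supp3_qpoch supp3_X_power)

definition part3 :: "nat \<Rightarrow> 'a::zero fps \<Rightarrow> 'a fps" where
  "part3 i x = Abs_fps (\<lambda>n. if n mod 3 = i then x $ n else 0)"

lemma supp3_part3: "supp3 i (part3 i x)"
  by (simp add: supp3_def part3_def)

lemma part3_decomp: "x = part3 0 x + part3 1 x + part3 2 (x :: 'a::comm_ring_1 fps)"
proof (rule fps_ext)
  fix n :: nat
  consider "n mod 3 = 0" | "n mod 3 = 1" | "n mod 3 = 2" by linarith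
  then show "x $ n = (part3 0 x + part3 1 x + part3 2 x) $ n"
    by cases (auto simp: part3_def)
qed

lemma part3_supp3: "supp3 i (x :: 'a::comm_ring_1 fps) \<Longrightarrow> part3 j x = (if i = j then x else 0)"
  by (auto simp: supp3_def part3_def fps_eq_iff)

lemma part3_add: "part3 i (x + y :: 'a::comm_ring_1 fps) = part3 i x + part3 i y"
  by (auto simp: part3_def fps_eq_iff)

lemma part3_unique:
  fixes x :: "'a::comm_ring_1 fps"
  assumes "x = a + b + c" "supp3 0 a" "supp3 1 b" "supp3 2 c"
  shows "part3 0 x = a" "part3 1 x = b" "part3 2 x = c"
  using assms by (simp_all add: part3_add part3_supp3)

text \<open>
  Up to the ring embedding, this is the product of \<open>x(q)\<close>, \<open>x(\<omega> q)\<close> and \<open>x(\<omega>\<^sup>2 q)\<close> for a primitive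
  cube root of unity \<open>\<omega>\<close>, written without leaving the coefficient ring.
\<close>
definition norm3 :: "'a::comm_ring_1 fps \<Rightarrow> 'a fps" where
  "norm3 x = part3 0 x ^ 3 + part3 1 x ^ 3 + part3 2 x ^ 3 - 3 * part3 0 x * part3 1 x * part3 2 x"

lemma part3_mult:
  fixes x y :: "'a::comm_ring_1 fps"
  shows "part3 0 (x * y) = part3 0 x * part3 0 y + part3 1 x * part3 2 y + part3 2 x * part3 1 y"
    and "part3 1 (x * y) = part3 0 x * part3 1 y + part3 1 x * part3 0 y + part3 2 x * part3 2 y"
    and "part3 2 (x * y) = part3 0 x * part3 2 y + part3 1 x * part3 1 y + part3 2 x * part3 0 y"
proof -
  have "x * y = (part3 0 x + part3 1 x + part3 2 x) * (part3 0 y + part3 1 y + part3 2 y)"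
    using part3_decomp[of x] part3_decomp[of y] by simp
  then have "x * y = (part3 0 x * part3 0 y + part3 1 x * part3 2 y + part3 2 x * part3 1 y)
     + (part3 0 x * part3 1 y + part3 1 x * part3 0 y + part3 2 x * part3 2 y)
     + (part3 0 x * part3 2 y + part3 1 x * part3 1 y + part3 2 x * part3 0 y)"
    by (simp add: algebra_simps)
  moreover have "supp3 0 (part3 0 x * part3 0 y + part3 1 x * part3 2 y + part3 2 x * part3 1 y)"
    "supp3 1 (part3 0 x * part3 1 y + part3 1 x * part3 0 y + part3 2 x * part3 2 y)"
    "supp3 2 (part3 0 x * part3 2 y + part3 1 x * part3 1 y + part3 2 x * part3 0 y)"
    by (intro supp3_add supp3_mult[OF supp3_part3 supp3_part3]; simp)+
  ultimately show "part3 0 (x * y) = part3 0 x * part3 0 y + part3 1 x * part3 2 y + part3 2 x * part3 1 y"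
    and "part3 1 (x * y) = part3 0 x * part3 1 y + part3 1 x * part3 0 y + part3 2 x * part3 2 y"
    and "part3 2 (x * y) = part3 0 x * part3 2 y + part3 1 x * part3 1 y + part3 2 x * part3 0 y"
    by (rule part3_unique)+
qed

text \<open>a^3 + b^3 + c^3 - 3abc is a circulant determinant and \<open>part3_mult\<close>
  multiplies circulants, so this is a polynomial identity in the parts.\<close>

lemma norm3_mult: "norm3 (x * y) = norm3 x * norm3 y"
  unfolding norm3_def part3_mult by (simp add: power3_eq_cube algebra_simps)

lemma norm3_supp3:
  assumes "supp3 0 x"
  shows "norm3 x = x ^ 3"
  by (simp add: norm3_def part3_supp3[OF assms])

lemma norm3_1: "norm3 1 = 1"
  by (simp add: norm3_supp3 supp3_1)

text \<open>(1 - y)(1 - \<omega> y)(1 - \<omega>^2 y) = 1 - y^3. Here 1 and \<open>q^k\<close> lie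
  in different classes, so the third part is zero and the mixed term vanishes.\<close>

lemma norm3_one_minus_X_power:
  assumes "\<not> 3 dvd k"
  shows "norm3 (1 - fps_X ^ k :: 'a::comm_ring_1 fps) = 1 - fps_X ^ (3 * k)"
proof -
  let ?y = "- (fps_X ^ k) :: 'a fps"
  have y: "supp3 i ?y" if "k mod 3 = i" for i
    using that by (intro supp3_uminus supp3_X_power)
  have "k mod 3 = 1 \<or> k mod 3 = 2"
    using assms by presburger
  then consider "k mod 3 = 1" | "k mod 3 = 2" by blast
  then have "norm3 (1 + ?y) = 1 + ?y ^ 3"
  proof cases
    case 1
    show ?thesis
      unfolding norm3_def part3_add part3_supp3[OF supp3_1] part3_supp3[OF y[OF 1]] by simp
  next
    case 2
    show ?thesis
      unfolding norm3_def part3_add part3_supp3[OF supp3_1] part3_supp3[OF y[OF 2]] by simp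
  qed
  then show ?thesis
    by (simp flip: power_mult add: mult.commute)
qed

lemma tendsto_part3:
  fixes f :: "'b \<Rightarrow> 'a::comm_ring_1 fps"
  assumes "(f \<longlongrightarrow> x) F"
  shows "((\<lambda>n. part3 i (f n)) \<longlongrightarrow> part3 i x) F"
proof (rule tendsto_fpsI)
  fix k
  have "\<forall>\<^sub>F n in F. f n $ k = x $ k"
    using assms unfolding tendsto_fps_iff by blast
  then show "\<forall>\<^sub>F n in F. part3 i (f n) $ k = part3 i x $ k"
    by eventually_elim (simp add: part3_def)
qed

lemma tendsto_norm3:
  fixes f :: "'b \<Rightarrow> 'a::comm_ring_1 fps"
  assumes "(f \<longlongrightarrow> x) F"
  shows "((\<lambda>n. norm3 (f n)) \<longlongrightarrow> norm3 x) F"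
  unfolding norm3_def
  by (intro tendsto_diff_fps tendsto_add_fps tendsto_power_fps tendsto_mult_fps tendsto_part3
      tendsto_const assms)

lemma euler_f_tendsto:
  assumes "m > 0"
  shows "(\<lambda>n. \<Prod>j<n. 1 - fps_X ^ (m * Suc j)) \<longlonglongrightarrow> euler_f m"
  using qpoch_tendsto[OF assms, of "fps_X ^ m"] assms by (simp add: euler_f_eq_qpoch power_add)

text \<open>The norm of \<open>1 - q^(m j)\<close> is \<open>1 - q^(3 m j)\<close> if 3 does not
  divide \<open>j\<close>, and the cube of the factor otherwise. The two kinds give f_(3m) / f_(9m)
  and f_(3m)^3.\<close>

lemma norm3_euler_f:
  assumes "\<not> 3 dvd m"
  shows "norm3 (euler_f m) * euler_f (9 * m) = euler_f (3 * m) ^ 4"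
proof -
  let ?P = "\<lambda>m n. \<Prod>j<n. 1 - fps_X ^ (m * Suc j) :: int fps"
  have m: "m > 0" using assms by (cases m) auto
  have mono: "strict_mono (\<lambda>n :: nat. 3 * n)"
    by (simp add: strict_mono_def)
  \<comment> \<open>The cut-off \<open>3 * n\<close> makes each induction step add one full set of
    residues modulo 3.\<close>
  have fin: "norm3 (?P m (3 * n)) * ?P (9 * m) n = ?P (3 * m) (3 * n) * ?P (3 * m) n ^ 3" for n
  proof (induction n)
    case (Suc n)
    define c :: "nat \<Rightarrow> int fps" where "c k = 1 - fps_X ^ k" for k
    have e: "3 * Suc n = Suc (Suc (Suc (3 * n)))" by simp
    have n: "\<not> 3 dvd m * Suc (3 * n)" "\<not> 3 dvd m * Suc (Suc (3 * n))"
    proof -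
      define t where "t = m * n"
      have "m * Suc (3 * n) = m + 3 * t" "m * Suc (Suc (3 * n)) = 2 * m + 3 * t"
        by (simp_all add: t_def)
      then show "\<not> 3 dvd m * Suc (3 * n)" "\<not> 3 dvd m * Suc (Suc (3 * n))"
        using assms by presburger+
    qed
    have n12: "norm3 (c (m * Suc (3 * n))) = c (3 * m * Suc (3 * n))"
        "norm3 (c (m * Suc (Suc (3 * n)))) = c (3 * m * Suc (Suc (3 * n)))"
      using norm3_one_minus_X_power[OF n(1)] norm3_one_minus_X_power[OF n(2)]
      unfolding c_def mult.assoc by (simp_all only:)
    have n3: "norm3 (c (m * Suc (Suc (Suc (3 * n))))) = c (3 * m * Suc n) ^ 3"
    proof -
      have k: "m * Suc (Suc (Suc (3 * n))) = 3 * m * Suc n" by simp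
      show ?thesis
        unfolding c_def k by (intro norm3_supp3 supp3_diff supp3_1 supp3_X_power) simp
    qed
    have c9: "c (9 * m * Suc n) = c (3 * m * Suc (Suc (Suc (3 * n))))"
      by (simp add: c_def algebra_simps)
    show ?case
      using Suc.IH unfolding e prod.lessThan_Suc norm3_mult c_def[symmetric] n12 n3 c9
      by algebra
  qed (simp add: norm3_1)
  have "(\<lambda>n. norm3 (?P m (3 * n)) * ?P (9 * m) n) \<longlonglongrightarrow> norm3 (euler_f m) * euler_f (9 * m)"
    using LIMSEQ_subseq_LIMSEQ[OF euler_f_tendsto[OF m] mono] m
    by (intro tendsto_mult_fps tendsto_norm3 euler_f_tendsto) (simp_all add: o_def)
  moreover have "(\<lambda>n. ?P (3 * m) (3 * n) * ?P (3 * m) n ^ 3)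
      \<longlonglongrightarrow> euler_f (3 * m) * euler_f (3 * m) ^ 3"
    using LIMSEQ_subseq_LIMSEQ[OF euler_f_tendsto[of "3 * m"] mono] m
    by (intro tendsto_mult_fps tendsto_power_fps euler_f_tendsto) (simp_all add: o_def)
  ultimately have "norm3 (euler_f m) * euler_f (9 * m) = euler_f (3 * m) * euler_f (3 * m) ^ 3"
    unfolding fin by (rule LIMSEQ_unique)
  then show ?thesis
    by (simp add: numeral_eq_Suc)
qed

section \<open>Extraction of the coefficients at multiples of 3\<close>

definition extract3 :: "'a::zero fps \<Rightarrow> 'a fps" where
  "extract3 x = Abs_fps (\<lambda>n. x $ (3 * n))"

lemma extract3_nth [simp]: "extract3 x $ n = x $ (3 * n)"
  by (simp add: extract3_def)

text \<open>Only indices divisible by 3 contribute to the convolution, so series in q^3 can be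
  pulled out of the extraction.\<close>

lemma extract3_mult_left:
  fixes x y :: "'a::comm_ring_1 fps"
  assumes "supp3 0 x"
  shows "extract3 (x * y) = extract3 x * extract3 y"
proof (rule fps_ext)
  fix n
  have "(\<Sum>i=0..3 * n. x $ i * y $ (3 * n - i)) = (\<Sum>i\<in>(*) 3 ` {0..n}. x $ i * y $ (3 * n - i))"
  proof (rule sum.mono_neutral_right)
    show "\<forall>i\<in>{0..3 * n} - (*) 3 ` {0..n}. x $ i * y $ (3 * n - i) = 0"
    proof
      fix i assume i: "i \<in> {0..3 * n} - (*) 3 ` {0..n}"
      have "\<not> 3 dvd i"
        using i by (auto elim!: dvdE)
      then have "x $ i = 0"
        using assms unfolding supp3_def by (metis dvd_eq_mod_eq_0)
      then show "x $ i * y $ (3 * n - i) = 0" by simp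
    qed
  qed auto
  also have "\<dots> = (\<Sum>i=0..n. x $ (3 * i) * y $ (3 * (n - i)))"
    by (subst sum.reindex) (auto simp: inj_on_def diff_mult_distrib2)
  finally show "extract3 (x * y) $ n = (extract3 x * extract3 y) $ n"
    by (simp add: fps_mult_nth)
qed

lemma extract3_add: "extract3 (x + y :: 'a::comm_ring_1 fps) = extract3 x + extract3 y"
  by (simp add: fps_eq_iff)

lemma extract3_part3: "extract3 x = extract3 (part3 0 x)"
  by (simp add: fps_eq_iff part3_def)

lemma extract3_X_power: "extract3 (fps_X ^ (3 * k) :: 'a::comm_ring_1 fps) = fps_X ^ k"
  by (simp add: fps_eq_iff)

lemma extract3_numeral: "extract3 (numeral k :: 'a::comm_ring_1 fps) = numeral k"
  by (auto simp: fps_eq_iff fps_numeral_nth)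

lemma extract3_power: "supp3 0 x \<Longrightarrow> extract3 (x ^ k :: 'a::comm_ring_1 fps) = extract3 x ^ k"
  by (induction k) (simp_all add: extract3_mult_left, simp add: fps_eq_iff)

lemma extract3_euler_f:
  assumes "m > 0"
  shows "extract3 (euler_f (3 * m)) = euler_f m"
proof -
  let ?P = "\<lambda>m n. \<Prod>j<n. 1 - fps_X ^ (m * Suc j) :: int fps"
  have fin: "extract3 (?P (3 * m) n) = ?P m n" for n
  proof (induction n)
    case (Suc n)
    have "supp3 0 (?P (3 * m) n)"
      by (intro supp3_prod supp3_diff supp3_1 supp3_X_power) simp
    moreover have "extract3 (1 - fps_X ^ (3 * m * Suc n)) = 1 - (fps_X :: int fps) ^ (m * Suc n)"
      by (simp add: fps_eq_iff)
    ultimately show ?case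
      using Suc.IH by (simp only: prod.lessThan_Suc extract3_mult_left)
  qed (simp add: fps_eq_iff)
  have "(\<lambda>n. extract3 (?P (3 * m) n)) \<longlonglongrightarrow> extract3 (euler_f (3 * m))"
  proof (rule tendsto_fpsI)
    fix k
    show "\<forall>\<^sub>F n in sequentially. extract3 (?P (3 * m) n) $ k = extract3 (euler_f (3 * m)) $ k"
      using euler_f_tendsto[of "3 * m"] assms unfolding tendsto_fps_iff extract3_nth by simp
  qed
  then show ?thesis
    using euler_f_tendsto[OF assms] unfolding fin by (rule LIMSEQ_unique)
qed

section \<open>The generating function\<close>

text \<open>The witnesses are \<open>phi * pi\<close> and \<open>om * psi\<close>; their product
  regroups as (phi psi)(om pi) = 2 B B.\<close>

lemma euler_f_1_2_dissect_3:
  obtains A E where "supp3 0 A" "supp3 0 E"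
    "euler_f 1 * euler_f 2 = A - fps_X * (euler_f 9 * euler_f 18) - fps_X ^ 2 * E"
    "A * E = 2 * (euler_f 9 * euler_f 18) ^ 2"
proof -
  define phi where "phi = theta (- (fps_X ^ 9)) (- (fps_X ^ 9)) 18"
  define psi where "psi = theta (fps_X ^ 9) 1 9"
  define om where "om = theta (- (fps_X ^ 15)) (- (fps_X ^ 3)) 18"
  define pi where "pi = theta (fps_X ^ 3) (fps_X ^ 6) 9"
  define B where "B = euler_f 9 * euler_f 18"
  have pp: "phi * psi = 2 * B"
    using theta_phi_times_psi[of 9] by (simp add: phi_def psi_def B_def)
  have op: "om * pi = B"
    using theta_omega_times_pi[of 3] by (simp add: om_def pi_def B_def)
  have "2 * (euler_f 1 * euler_f 2) = theta (- fps_X) (- fps_X) 2 * theta fps_X 1 1"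
    using theta_phi_times_psi[of 1] by simp
  also have "\<dots> = (phi - 2 * fps_X * om) * (2 * pi + fps_X * psi)"
    unfolding theta_phi_dissect theta_psi_dissect phi_def psi_def om_def pi_def ..
  also have "\<dots> = 2 * (phi * pi) + fps_X * (phi * psi) - 4 * fps_X * (om * pi) - 2 * fps_X ^ 2 * (om * psi)"
    by (simp add: algebra_simps power2_eq_square)
  \<comment> \<open>The terms with B combine to (2 - 4) q B, so a common factor 2 can be
    cancelled.\<close>
  also have "\<dots> = 2 * (phi * pi - fps_X * B - fps_X ^ 2 * (om * psi))"
    unfolding pp op by (simp add: algebra_simps)
  finally have "2 * (euler_f 1 * euler_f 2) = 2 * (phi * pi - fps_X * B - fps_X ^ 2 * (om * psi))" .
  then have "euler_f 1 * euler_f 2 = phi * pi - fps_X * B - fps_X ^ 2 * (om * psi)"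
    by (simp only: mult_left_cancel[OF zero_neq_numeral[symmetric]])
  moreover have "(phi * pi) * (om * psi) = (phi * psi) * (om * pi)"
    by (simp only: ac_simps)
  then have "(phi * pi) * (om * psi) = 2 * B ^ 2"
    unfolding pp op by (simp add: power2_eq_square)
  moreover have "supp3 0 phi" "supp3 0 psi" "supp3 0 om" "supp3 0 pi"
    unfolding phi_def psi_def om_def pi_def
    by (intro supp3_theta supp3_uminus supp3_X_power supp3_1; simp)+
  then have "supp3 0 (phi * pi)" "supp3 0 (om * psi)"
    by (auto intro: supp3_mult[of 0 _ 0])
  ultimately show ?thesis
    using that unfolding B_def by blast
qed

lemma extract3_numeral_mult:
  "extract3 (numeral k * x :: 'a::comm_ring_1 fps) = numeral k * extract3 x"
  by (simp add: extract3_mult_left supp3_numeral extract3_numeral)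

lemma extract3_X_power_mult:
  "extract3 (fps_X ^ (3 * k) * x :: 'a::comm_ring_1 fps) = fps_X ^ k * extract3 x"
  by (simp add: extract3_mult_left supp3_X_power extract3_X_power)

lemma extract3_uminus: "extract3 (- x :: 'a::comm_ring_1 fps) = - extract3 x"
  by (simp add: fps_eq_iff)

definition CP3_cusp :: "int fps" where
  "CP3_cusp = fps_X * (euler_f 3 * euler_f 6) ^ 2 * (euler_f 1 * euler_f 2) ^ 2"

lemma extract3_recurrences:
  shows extract3_CP3: "extract3 (fps_X ^ 2 * Abs_fps CP3) = 27 * (fps_X ^ 2 * Abs_fps CP3) + 2 * CP3_cusp"
    and extract3_CP3_cusp: "extract3 CP3_cusp = - 3 * CP3_cusp"
proof -
  define x G B where "x = euler_f 1 * euler_f 2" and "G = euler_f 3 * euler_f 6"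
    and "B = euler_f 9 * euler_f 18"
  define F where "F = fps_X ^ 2 * Abs_fps CP3"
  obtain A E where A: "supp3 0 A" and E: "supp3 0 E"
    and x: "x = A - fps_X * B - fps_X ^ 2 * E" and AE: "A * E = 2 * B ^ 2"
    using euler_f_1_2_dissect_3 unfolding x_def B_def by blast
  have G: "supp3 0 G" and B: "supp3 0 B"
    unfolding G_def B_def by (auto intro!: supp3_mult[of 0 _ 0] supp3_euler_f)
  have "extract3 (euler_f 3) = euler_f 1" "extract3 (euler_f 6) = euler_f 2"
       "extract3 (euler_f 9) = euler_f 3" "extract3 (euler_f 18) = euler_f 6"
    using extract3_euler_f[of 1] extract3_euler_f[of 2] extract3_euler_f[of 3] extract3_euler_f[of 6]
    by simp_all
  then have eG: "extract3 G = x" and eB: "extract3 B = G"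
    unfolding G_def B_def x_def by (simp_all add: extract3_mult_left supp3_euler_f)
  have nz: "x \<noteq> 0" "G \<noteq> 0"
    using euler_f_has_prod(2)[of 1] euler_f_has_prod(2)[of 2] euler_f_has_prod(2)[of 3]
      euler_f_has_prod(2)[of 6] unfolding x_def G_def by auto
  have s1: "supp3 1 (fps_X * y)" and s2: "supp3 2 (fps_X ^ 2 * y)" if "supp3 0 y" for y :: "int fps"
    using that supp3_X_power[of 1 1, where 'a = int] supp3_X_power[of 2 2, where 'a = int]
    by (auto intro: supp3_mult)
  have px: "part3 0 x = A" "part3 1 x = - (fps_X * B)" "part3 2 x = - (fps_X ^ 2 * E)"
  proof -
    have "x = A + - (fps_X * B) + - (fps_X ^ 2 * E)"
      unfolding x by simp
    note * = part3_unique[OF this A supp3_uminus[OF s1[OF B]] supp3_uminus[OF s2[OF E]]]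
    show "part3 0 x = A" "part3 1 x = - (fps_X * B)" "part3 2 x = - (fps_X ^ 2 * E)"
      by (fact *)+
  qed

  \<comment> \<open>\<open>P\<close> is the norm of \<open>x\<close> after
    \<open>A * E = 2 * B ^ 2\<close>, so 7 = 1 + 3 * 2. \<open>N\<close> is the product of the other
    two conjugates: with a, b, c the parts of \<open>x\<close>, its parts are a^2 - b c, c^2 - a b
    and b^2 - a c.\<close>
  define P where "P = A ^ 3 - 7 * fps_X ^ 3 * B ^ 3 - fps_X ^ 6 * E ^ 3"
  define N0 N1 N2 where "N0 = A ^ 2 - fps_X ^ 3 * (B * E)"
    and "N1 = fps_X * (A * B + fps_X ^ 3 * E ^ 2)" and "N2 = fps_X ^ 2 * (3 * B ^ 2)"
  define N where "N = N0 + N1 + N2"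
  have P: "norm3 x = P"
  proof -
    have "norm3 x = A ^ 3 - fps_X ^ 3 * B ^ 3 - fps_X ^ 6 * E ^ 3 - 3 * fps_X ^ 3 * B * (A * E)"
      unfolding norm3_def px by (simp add: algebra_simps eval_nat_numeral)
    then show ?thesis
      unfolding AE P_def by (simp add: algebra_simps eval_nat_numeral)
  qed
  have PB: "P * B = G ^ 4"
  proof -
    have "norm3 (euler_f 1) * euler_f 9 = euler_f 3 ^ 4" "norm3 (euler_f 2) * euler_f 18 = euler_f 6 ^ 4"
      using norm3_euler_f[of 1] norm3_euler_f[of 2] by simp_all
    then show ?thesis
      unfolding P[symmetric] x_def norm3_mult B_def G_def power_mult_distrib by (metis mult.assoc mult.left_commute)
  qed
  have xN: "x * N = P"
    using AE unfolding x N_def N0_def N1_def N2_def P_def by algebra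
  have "supp3 0 N0" "supp3 1 N1" "supp3 2 N2"
    unfolding N0_def N1_def N2_def
    by (intro s1 s2 supp3_diff supp3_add supp3_power supp3_mult[of 0 _ 0] supp3_X_power supp3_numeral A B E; simp)+
  then have pN: "part3 0 N = N0" "part3 1 N = N1" "part3 2 N = N2"
    using part3_unique[OF N_def] by blast+
  \<comment> \<open>This part is 2 N0 N1 + N2^2; the 27 is 18 from the first term plus 9 from the
    second.\<close>
  have pNN: "part3 1 (N * N) = 2 * fps_X * B * P + 27 * fps_X ^ 4 * B ^ 4"
    unfolding part3_mult pN using AE unfolding N0_def N1_def N2_def P_def by algebra

  have Fx: "F * x ^ 2 = fps_X ^ 2 * G ^ 6"
    using CP3_generating_function unfolding F_def x_def G_def power_mult_distrib
    by (simp add: mult.assoc)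
  \<comment> \<open>This is F = q^2 G^6 / x^2 with 1/x = N/P and P = G^4 / B, cleared of
    denominators.\<close>
  have "G ^ 6 * (G ^ 2 * F) = G ^ 6 * (fps_X ^ 2 * B ^ 2 * (N * N))"
    using Fx xN PB by algebra
  then have FG: "G ^ 2 * F = fps_X ^ 2 * B ^ 2 * (N * N)"
    by (rule iffD1[OF mult_left_cancel[OF power_not_zero[OF nz(2)]]])
  have "extract3 (G ^ 2 * F) = x ^ 2 * extract3 F"
    by (simp add: extract3_mult_left extract3_power supp3_power G eG)
  \<comment> \<open>\<open>q^2 B^2\<close> lies in class 2, so exactly class 1 of
    \<open>N * N\<close> lands on multiples of 3.\<close>
  moreover have "part3 0 (G ^ 2 * F) = fps_X ^ (3 * 1) * (2 * (B ^ 2 * G ^ 4)) + fps_X ^ (3 * 2) * (27 * B ^ 6)"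
  proof -
    have "part3 0 (G ^ 2 * F) = fps_X ^ 2 * B ^ 2 * part3 1 (N * N)"
      unfolding FG using part3_supp3[OF s2[OF supp3_power[OF B, of 2]]] by (simp add: part3_mult(1))
    also have "\<dots> = fps_X ^ 3 * (2 * (B ^ 2 * G ^ 4)) + fps_X ^ 6 * (27 * B ^ 6)"
      unfolding pNN using PB by algebra
    finally show ?thesis by simp
  qed
  \<comment> \<open>Extraction sends q^3 to q, \<open>B\<close> to \<open>G\<close> and
    \<open>G\<close> to \<open>x\<close>.\<close>
  moreover have "extract3 (fps_X ^ (3 * 1) * (2 * (B ^ 2 * G ^ 4)) + fps_X ^ (3 * 2) * (27 * B ^ 6))
      = fps_X * (2 * (G ^ 2 * x ^ 4)) + fps_X ^ 2 * (27 * G ^ 6)"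
    unfolding extract3_add extract3_X_power_mult extract3_numeral_mult
    by (simp add: extract3_mult_left extract3_power supp3_power G B eG eB)
  ultimately have "x ^ 2 * extract3 F = fps_X * (2 * (G ^ 2 * x ^ 4)) + fps_X ^ 2 * (27 * G ^ 6)"
    using extract3_part3[of "G ^ 2 * F"] by simp
  also have "\<dots> = x ^ 2 * (27 * F + 2 * (fps_X * G ^ 2 * x ^ 2))"
    using Fx by algebra
  finally have "extract3 F = 27 * F + 2 * (fps_X * G ^ 2 * x ^ 2)"
    by (rule iffD1[OF mult_left_cancel[OF power_not_zero[OF nz(1)]]])
  then show "extract3 (fps_X ^ 2 * Abs_fps CP3) = 27 * (fps_X ^ 2 * Abs_fps CP3) + 2 * CP3_cusp"
    unfolding F_def CP3_cusp_def x_def G_def .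

  have C: "CP3_cusp = G ^ 2 * (fps_X * (x * x))"
    unfolding CP3_cusp_def G_def x_def by (simp add: power2_eq_square ac_simps)
  have "part3 0 (fps_X * (x * x)) = fps_X * part3 2 (x * x)"
    using part3_supp3[OF s1[OF supp3_1]] by (simp add: part3_mult(1))
  \<comment> \<open>The part of class 2 is - 2 q^2 A E + q^2 B^2 = (-4 + 1) q^2 B^2.\<close>
  also have "\<dots> = - (fps_X ^ (3 * 1) * (3 * B ^ 2))"
    unfolding part3_mult px mult_1_right using AE by algebra
  finally have "extract3 (fps_X * (x * x)) = - (fps_X * (3 * G ^ 2))"
    using extract3_part3[of "fps_X * (x * x)"]
    by (simp only: extract3_uminus extract3_X_power_mult extract3_numeral_mult extract3_power[OF B] eB power_one_right)
  then have "extract3 CP3_cusp = x ^ 2 * - (fps_X * (3 * G ^ 2))"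
    unfolding C by (simp add: extract3_mult_left extract3_power supp3_power G eG)
  then show "extract3 CP3_cusp = - 3 * CP3_cusp"
    unfolding C by (simp add: power2_eq_square ac_simps)
qed

section \<open>Divisibility by powers of 3 and by 2\<close>

lemma CP3_cusp_nth: "CP3_cusp $ (3 ^ k * m) = (- 3) ^ k * CP3_cusp $ m"
proof (induction k)
  case (Suc k)
  have "CP3_cusp $ (3 ^ Suc k * m) = extract3 CP3_cusp $ (3 ^ k * m)"
    by (simp add: mult.assoc)
  also have "\<dots> = - 3 * CP3_cusp $ (3 ^ k * m)"
    unfolding extract3_CP3_cusp fps_mult_left_const_nth[symmetric] by (simp add: numeral_fps_const)
  finally show ?case
    using Suc.IH by simp
qed simp

text \<open>In the recurrence, 27 supplies a further 3 for the first term, and the eigenvalue -3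
  supplies the power for the cusp form. The exponent lags by one because the cusp form enters one
  level lower.\<close>

lemma three_power_dvd_CP3: "3 ^ k dvd (fps_X ^ 2 * Abs_fps CP3) $ (3 ^ Suc k * m)"
proof (induction k)
  case (Suc k)
  let ?F = "fps_X ^ 2 * Abs_fps CP3"
  have "?F $ (3 ^ Suc (Suc k) * m) = extract3 ?F $ (3 ^ Suc k * m)"
    by (simp add: mult.assoc)
  also have "\<dots> = 27 * ?F $ (3 ^ Suc k * m) + 2 * CP3_cusp $ (3 ^ Suc k * m)"
    unfolding extract3_CP3 by (simp add: numeral_fps_const del: power_Suc)
  also have "\<dots> = 3 * (9 * ?F $ (3 ^ Suc k * m)) + 3 ^ Suc k * (2 * (- 1) ^ Suc k * CP3_cusp $ m)"
    unfolding CP3_cusp_nth by (simp add: power_minus[of 3])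
  also have "3 ^ Suc k dvd \<dots>"
    using Suc.IH by (intro dvd_add dvd_triv_left) (simp add: mult_dvd_mono)
  finally show ?case .
qed simp

text \<open>The indices \<open>i\<close> and \<open>n - i\<close> contribute equally and never
  coincide for odd \<open>n\<close>.\<close>

lemma even_square_nth_odd:
  fixes h :: "int fps"
  assumes "odd n"
  shows "even ((h * h) $ n)"
proof -
  obtain m where n: "n = 2 * m + 1"
    using assms by (rule oddE)
  let ?f = "\<lambda>i. h $ i * h $ (n - i)"
  have "{0..n} = {0..m} \<union> {m + 1..n}" "{0..m} \<inter> {m + 1..n} = {}"
    using n by auto
  then have "(h * h) $ n = sum ?f {0..m} + sum ?f {m + 1..n}"
    unfolding fps_mult_nth by (simp add: sum.union_disjoint)
  also have "sum ?f {m + 1..n} = sum ?f {0..m}"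
    by (rule sum.reindex_bij_witness[of _ "\<lambda>i. n - i" "\<lambda>i. n - i"]) (auto simp: n)
  finally show ?thesis by simp
qed

lemma CP3_even: "odd n \<Longrightarrow> even (CP3 n)"
proof -
  assume "odd n"
  let ?x = "euler_f 1 * euler_f 2"
  define R where "R = fps_right_inverse ?x 1"
  have R: "?x * R = 1"
    unfolding R_def using euler_f_has_prod(2)[of 1] euler_f_has_prod(2)[of 2]
    by (intro fps_right_inverse) simp
  \<comment> \<open>The square root of the generating function, integral because \<open>?x\<close>
    has constant term 1.\<close>
  define h where "h = euler_f 3 ^ 3 * euler_f 6 ^ 3 * R"
  have "Abs_fps CP3 = h * h"
    using CP3_generating_function R unfolding h_def by algebra
  then have "CP3 n = (h * h) $ n"
    by (metis fps_nth_Abs_fps)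
  then show ?thesis
    using even_square_nth_odd[OF \<open>odd n\<close>] by simp
qed

theorem theorem3p9:
  fixes k n :: nat
  assumes "k \<ge> 1" and "n \<ge> 1"
  shows "[CP3 (2 * 3 ^ k * n + 3 ^ k - 2) = 0] (mod (2 * 3 ^ (k - 1)))"
proof -
  define j where "j = 2 * 3 ^ k * n + 3 ^ k - 2"
  obtain l where k: "k = Suc l"
    using assms(1) by (cases k) auto
  \<comment> \<open>This makes 3^k at least 3, so the natural-number subtraction of 2 is
    exact.\<close>
  have "(1 :: nat) \<le> 3 ^ l" by simp
  then have "2 \<le> 2 * 3 ^ k * n + 3 ^ k"
    unfolding k power_Suc by linarith
  then have "j + 2 = 2 * 3 ^ k * n + 3 ^ k"
    unfolding j_def by (rule le_add_diff_inverse2)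
  \<comment> \<open>The factor q^2 in front of the generating function absorbs the - 2, leaving an
    odd multiple of 3^k as index.\<close>
  then have j: "j + 2 = 3 ^ Suc l * (2 * n + 1)"
    by (simp add: k algebra_simps)
  then have "odd (j + 2)"
    by (simp only: even_mult_iff even_power) simp
  then have "2 dvd CP3 j"
    by (intro CP3_even) simp
  moreover have "CP3 j = (fps_X ^ 2 * Abs_fps CP3) $ (j + 2)"
    by (simp add: fps_X_power_mult_nth)
  then have "3 ^ l dvd CP3 j"
    using three_power_dvd_CP3[of l "2 * n + 1"] unfolding j by (simp only:)
  moreover have "coprime 2 (3 ^ l :: int)"
    by simp
  ultimately have "2 * 3 ^ l dvd CP3 j"
    by (intro divides_mult)
  then show ?thesis
    by (simp add: cong_0_iff j_def k)
qed

end
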